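(* Let $\alpha>0$, $\tau>0$, $k,n\in\mathbb{N}$, and consider the generalized non-linear time-fractional PDE with time delay $$\frac{\partial^\alpha u}{\partial t^\alpha}=\mathcal{G}[u,\bar u],\tag{$*$}$$ with $u=u(x,t)$ prescribed for $t\in[-\tau,0]$, where $\bar u=u(x,t-\tau)$ and $\mathcal{G}[u,\bar u]=\widetilde{\mathcal{G}}\left[x,u,\bar u,\frac{\partial u}{\partial x},\frac{\partial\bar u}{\partial x},\dots,\frac{\partial^k u}{\partial x^k},\frac{\partial^k\bar u}{\partial x^k}\right]$ is a non-linear differential operator of order $k$ (possibly non-linear also in the delayed terms). Let $\mathcal{W}_n=\mathrm{Span}\{\varphi_1(x),\dots,\varphi_n(x)\}$ be the $n$-dimensional solution space of a linear ODE $a_n z^{(n)}+a_{n-1}z^{(n-1)}+\dots+a_1z'+a_0z=0$ with real coefficients, with $\varphi_1,\dots,\varphi_n$ linearly independent. If $\mathcal{W}_n$ is invariant under $\mathcal{G}[u,\bar u]$, then $( * )$ possesses generalized separable solutions of the form $$u(x,t)=\sum_{j=1}^nA_j(t)\varphi_j(x),$$ where the coefficients $A_j(t)$ satisfy the system of fractional delay ODEs $$\frac{d^\alpha A_j(t)}{dt^\alpha}=\Psi_j\big(A_1(t),\dots,A_n(t),A_1(t-\tau),\dots,A_n(t-\tau)\big),\qquad j=1,\dots,n;$$ that is, if $A_1,\dots,A_n$ satisfy this system for $t>0$, then $u$ satisfies $( * )$ for $t>0$.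
   Context: The derivative $\partial^\alpha/\partial t^\alpha$ (and $d^\alpha/dt^\alpha$) is the fractional derivative of order $\alpha$ in $t$ (based at $0$), taken in either the Riemann–Liouville or the Caputo sense (the same sense in the PDE and in the ODE system). For $p-1<\alpha<p$, $p\in\mathbb{N}$, the Caputo derivative is $\frac{1}{\Gamma(p-\alpha)}\int_0^t\frac{\varphi^{(p)}(s)}{(t-s)^{\alpha-p+1}}\,ds$ and the Riemann–Liouville derivative is $\frac{1}{\Gamma(p-\alpha)}\frac{d^p}{dt^p}\int_0^t\frac{\varphi(s)}{(t-s)^{\alpha-p+1}}\,ds$; for $\alpha=p$ both are $\varphi^{(p)}$. The space $\mathcal{W}_n$ is said to be invariant under $\mathcal{G}$ if $\mathcal{G}[\mathcal{W}_n,\mathcal{W}_n]\subseteq\mathcal{W}_n$, i.e. $\mathcal{G}[u,\bar u]\in\mathcal{W}_n$ for all $u,\bar u\in\mathcal{W}_n$. In that case $\Psi_1,\dots,\Psi_n$ denote the functions determined by $\mathcal{G}\left[\sum_{j=1}^nA_j\varphi_j(x),\sum_{j=1}^n\bar A_j\varphi_j(x)\right]=\sum_{j=1}^n\Psi_j(A_1,\dots,A_n,\bar A_1,\dots,\bar A_n)\varphi_j(x)$ for all real $A_j,\bar A_j$. *)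

theory Defs
  imports "HOL-Analysis.Analysis"
begin

text \<open>
  \<open>S\<close> is meant to be open; \<^term>\<open>(deriv ^^ i) f\<close> is the \<open>i\<close>-th derivative, which is a total
  function in HOL, so existence is recorded separately.
\<close>

definition times_differentiable_on :: "nat \<Rightarrow> (real \<Rightarrow> real) \<Rightarrow> real set \<Rightarrow> bool" where
  "times_differentiable_on m f S \<longleftrightarrow> (\<forall>i<m. \<forall>x\<in>S. (deriv ^^ i) f differentiable at x)"


datatype frac_sense = Riemann_Liouville | Caputo

text \<open>For \<open>\<alpha> > 0\<close> this is the \<open>p\<close> with \<open>p - 1 < \<alpha> \<le> p\<close>.\<close>

definition frac_order :: "real \<Rightarrow> nat" where
  "frac_order \<alpha> = nat \<lceil>\<alpha>\<rceil>"

definition frac_kernel :: "real \<Rightarrow> (real \<Rightarrow> real) \<Rightarrow> real \<Rightarrow> real \<Rightarrow> real" where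
  "frac_kernel \<alpha> g t s = g s / (t - s) powr (\<alpha> - real (frac_order \<alpha>) + 1)"

text \<open>The fractional derivative of order \<open>\<alpha>\<close> based at \<open>0\<close>, evaluated at \<open>t > 0\<close>.\<close>

fun frac_deriv :: "frac_sense \<Rightarrow> real \<Rightarrow> (real \<Rightarrow> real) \<Rightarrow> real \<Rightarrow> real" where
  "frac_deriv Caputo \<alpha> f t =
     (let p = frac_order \<alpha> in
      if \<alpha> = real p then (deriv ^^ p) f t
      else 1 / Gamma (real p - \<alpha>) * integral {0..t} (frac_kernel \<alpha> ((deriv ^^ p) f) t))"
| "frac_deriv Riemann_Liouville \<alpha> f t =
     (let p = frac_order \<alpha> in
      if \<alpha> = real p then (deriv ^^ p) f t
      else 1 / Gamma (real p - \<alpha>) * (deriv ^^ p) (\<lambda>r. integral {0..r} (frac_kernel \<alpha> f r)) t)"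

text \<open>
  Existence of the fractional derivative at every \<open>t > 0\<close>: all derivatives in the defining formula
  exist classically, and all integrals exist as Lebesgue integrals.
\<close>

fun frac_differentiable :: "frac_sense \<Rightarrow> real \<Rightarrow> (real \<Rightarrow> real) \<Rightarrow> bool" where
  "frac_differentiable Caputo \<alpha> f \<longleftrightarrow>
     (let p = frac_order \<alpha> in
      times_differentiable_on p f {0<..} \<and>
      (\<alpha> \<noteq> real p \<longrightarrow>
        (\<forall>t>0. frac_kernel \<alpha> ((deriv ^^ p) f) t absolutely_integrable_on {0..t})))"
| "frac_differentiable Riemann_Liouville \<alpha> f \<longleftrightarrow>
     (let p = frac_order \<alpha> in
      if \<alpha> = real p then times_differentiable_on p f {0<..}
      else (\<forall>t>0. frac_kernel \<alpha> f t absolutely_integrable_on {0..t}) \<and>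
           times_differentiable_on p (\<lambda>r. integral {0..r} (frac_kernel \<alpha> f r)) {0<..})"


definition lin_comb :: "('n::finite \<Rightarrow> real \<Rightarrow> real) \<Rightarrow> real ^ 'n \<Rightarrow> real \<Rightarrow> real" where
  "lin_comb \<phi> c = (\<lambda>x. \<Sum>j\<in>UNIV. c $ j * \<phi> j x)"

definition fun_span :: "('n::finite \<Rightarrow> real \<Rightarrow> real) \<Rightarrow> (real \<Rightarrow> real) set" where
  "fun_span \<phi> = range (lin_comb \<phi>)"

definition fun_independent :: "('n::finite \<Rightarrow> real \<Rightarrow> real) \<Rightarrow> bool" where
  "fun_independent \<phi> \<longleftrightarrow> (\<forall>c. (\<forall>x. lin_comb \<phi> c x = 0) \<longrightarrow> c = 0)"

definition ode_solution_space :: "nat \<Rightarrow> (nat \<Rightarrow> real) \<Rightarrow> (real \<Rightarrow> real) set" where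
  "ode_solution_space n a =
     {z. times_differentiable_on n z UNIV \<and> (\<forall>x. (\<Sum>i\<le>n. a i * (deriv ^^ i) z x) = 0)}"


text \<open>
  The operator \<open>\<G>[u, v](x) = \<G>'[x, u, v, u', v', \<dots>]\<close>, where the arbitrary function \<open>\<G>'\<close> receives
  the lists \<open>[u x, u' x, \<dots>]\<close> and \<open>[v x, v' x, \<dots>]\<close> of derivatives up to order \<open>k\<close>.
\<close>

definition diff_operator ::
  "nat \<Rightarrow> (real \<Rightarrow> real list \<Rightarrow> real list \<Rightarrow> real) \<Rightarrow>
   (real \<Rightarrow> real) \<Rightarrow> (real \<Rightarrow> real) \<Rightarrow> real \<Rightarrow> real" where
  "diff_operator k G' u v x =
     G' x (map (\<lambda>i. (deriv ^^ i) u x) [0..<Suc k]) (map (\<lambda>i. (deriv ^^ i) v x) [0..<Suc k])"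

definition invariant_under ::
  "(real \<Rightarrow> real) set \<Rightarrow> ((real \<Rightarrow> real) \<Rightarrow> (real \<Rightarrow> real) \<Rightarrow> real \<Rightarrow> real) \<Rightarrow> bool" where
  "invariant_under W G \<longleftrightarrow> (\<forall>u\<in>W. \<forall>v\<in>W. G u v \<in> W)"

text \<open>\<open>\<Psi> A B $ j\<close> is \<open>\<Psi>\<^sub>j(A\<^sub>1, \<dots>, A\<^sub>n, B\<^sub>1, \<dots>, B\<^sub>n)\<close>.\<close>

definition coefficient_functions ::
  "((real \<Rightarrow> real) \<Rightarrow> (real \<Rightarrow> real) \<Rightarrow> real \<Rightarrow> real) \<Rightarrow> ('n::finite \<Rightarrow> real \<Rightarrow> real) \<Rightarrow>
   (real ^ 'n \<Rightarrow> real ^ 'n \<Rightarrow> real ^ 'n) \<Rightarrow> bool" where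
  "coefficient_functions G \<phi> \<Psi> \<longleftrightarrow>
     (\<forall>A B. G (lin_comb \<phi> A) (lin_comb \<phi> B) = lin_comb \<phi> (\<Psi> A B))"


text \<open>
  In both problems the unknown is a function on the times \<open>t \<ge> -\<tau>\<close>: it is the prescribed history
  \<open>h\<close> on \<open>[-\<tau>, 0]\<close>, and the equation is imposed for \<open>t > 0\<close>. Values at \<open>t < -\<tau>\<close> are irrelevant.
\<close>

definition delay_pde_solution ::
  "frac_sense \<Rightarrow> real \<Rightarrow> real \<Rightarrow> nat \<Rightarrow> (real \<Rightarrow> real list \<Rightarrow> real list \<Rightarrow> real) \<Rightarrow>
   (real \<Rightarrow> real \<Rightarrow> real) \<Rightarrow> (real \<Rightarrow> real \<Rightarrow> real) \<Rightarrow> bool" where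
  "delay_pde_solution s \<alpha> \<tau> k G' h u \<longleftrightarrow>
     (\<forall>x. \<forall>t\<in>{-\<tau>..0}. u x t = h x t) \<and>
     (\<forall>t>-\<tau>. times_differentiable_on k (\<lambda>x. u x t) UNIV) \<and>
     (\<forall>x. frac_differentiable s \<alpha> (u x)) \<and>
     (\<forall>x. \<forall>t>0. frac_deriv s \<alpha> (u x) t =
        diff_operator k G' (\<lambda>y. u y t) (\<lambda>y. u y (t - \<tau>)) x)"

definition delay_system_solution ::
  "frac_sense \<Rightarrow> real \<Rightarrow> real \<Rightarrow> (real ^ 'n \<Rightarrow> real ^ 'n \<Rightarrow> real ^ 'n) \<Rightarrow>
   (real \<Rightarrow> real ^ 'n::finite) \<Rightarrow> (real \<Rightarrow> real ^ 'n) \<Rightarrow> bool" where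
  "delay_system_solution s \<alpha> \<tau> \<Psi> h A \<longleftrightarrow>
     (\<forall>t\<in>{-\<tau>..0}. A t = h t) \<and>
     (\<forall>j. frac_differentiable s \<alpha> (\<lambda>t. A t $ j)) \<and>
     (\<forall>j. \<forall>t>0. frac_deriv s \<alpha> (\<lambda>r. A r $ j) t = \<Psi> (A t) (A (t - \<tau>)) $ j)"

end

theory Submission
  imports Defs
begin

text \<open>For fixed \<open>x\<close> the numbers \<open>\<phi> j x\<close> are constants in time,
  so by linearity the fractional derivative in time of the separable sum is the combination of the
  fractional derivatives of the \<open>A t $ j\<close> with these weights. The delay system turns it
  into \<open>lin_comb \<phi> (\<Psi> (A t) (A (t - \<tau>))) x\<close>, and by the defining
  property of \<open>\<Psi>\<close> this is the operator applied to the profiles at times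
  \<open>t\<close> and \<open>t - \<tau>\<close>, both of which lie in the span.

  Linearity is \<open>frac_sum\<close>; it must also deliver existence, in either sense. It rests on
  \<open>higher_deriv_sum\<close> for iterated derivatives on an open set and on
  \<open>integral_frac_kernel_sum\<close> for the singular integrals.
  \<open>ode_solution_smooth\<close> supplies the spatial derivatives that the operator reads, and
  \<open>ex1_coefficient_functions\<close> shows that \<open>\<Psi>\<close> is well defined.\<close>

lemma higher_deriv_cong_open:
  assumes "open S" and "\<And>x. x \<in> S \<Longrightarrow> f x = g x" and "x \<in> S"
  shows "(deriv ^^ i) f x = (deriv ^^ i) g (x :: real)"
  using \<open>x \<in> S\<close>
proof (induction i arbitrary: x)
  case 0
  then show ?case using assms(2) by simp
next
  case (Suc i)
  \<comment> \<open>The value of \<open>deriv\<close> at \<open>x\<close> depends only on the germ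
    there, so the induction hypothesis is needed on a whole neighbourhood.\<close>
  have "\<forall>\<^sub>F y in nhds x. (deriv ^^ i) f y = (deriv ^^ i) g y"
    using eventually_nhds_in_open[OF assms(1) Suc.prems] by eventually_elim (rule Suc.IH)
  then show ?case by (simp add: deriv_cong_ev)
qed

lemma differentiable_cong_open:
  fixes f g :: "real \<Rightarrow> real"
  assumes "open S" and "\<And>x. x \<in> S \<Longrightarrow> f x = g x" and "x \<in> S"
  shows "f differentiable at x \<longleftrightarrow> g differentiable at x"
proof -
  have *: "h2 differentiable at x"
    if "\<And>x. x \<in> S \<Longrightarrow> h1 x = h2 x" and "h1 differentiable at x" for h1 h2 :: "real \<Rightarrow> real"
    using that(2) has_derivative_transform_within_open[OF _ assms(1,3) that(1)]
    unfolding differentiable_def by fast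
  show ?thesis by (rule iffI; erule *[rotated]) (simp_all add: assms(2))
qed

lemma times_differentiable_on_cong:
  assumes "open S" and "\<And>x. x \<in> S \<Longrightarrow> f x = g x"
  shows "times_differentiable_on m f S \<longleftrightarrow> times_differentiable_on m g S"
proof -
  have "(deriv ^^ i) f differentiable at x \<longleftrightarrow> (deriv ^^ i) g differentiable at x" if "x \<in> S" for i x
    using assms(1) higher_deriv_cong_open[OF assms] that by (rule differentiable_cong_open)
  then show ?thesis by (simp add: times_differentiable_on_def)
qed

text \<open>Differentiating an order \<open>i < m\<close> once more stays within the assumed
  regularity, so the top order \<open>i = m\<close> is covered too. The weights \<open>c j\<close>
  stand on the right because they will be the values \<open>\<phi> j x\<close> at a frozen
  \<open>x\<close>.\<close>

lemma higher_deriv_sum: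
  fixes f :: "'i \<Rightarrow> real \<Rightarrow> real"
  assumes "open S" and "finite I" and "\<And>j. j \<in> I \<Longrightarrow> times_differentiable_on m (f j) S"
    and "i \<le> m" and "x \<in> S"
  shows "(deriv ^^ i) (\<lambda>x. \<Sum>j\<in>I. f j x * c j) x = (\<Sum>j\<in>I. (deriv ^^ i) (f j) x * c j)"
  using \<open>i \<le> m\<close> \<open>x \<in> S\<close>
proof (induction i arbitrary: x)
  case (Suc i)
  have "((deriv ^^ i) (f j) has_real_derivative (deriv ^^ Suc i) (f j) x) (at x)" if "j \<in> I" for j
    using assms(3)[OF that] Suc.prems
    by (simp add: times_differentiable_on_def DERIV_deriv_iff_real_differentiable)
  then have "((\<lambda>x. \<Sum>j\<in>I. (deriv ^^ i) (f j) x * c j) has_real_derivative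
      (\<Sum>j\<in>I. (deriv ^^ Suc i) (f j) x * c j)) (at x)"
    by (intro DERIV_sum DERIV_cmult_right)
  moreover have "deriv ((deriv ^^ i) (\<lambda>x. \<Sum>j\<in>I. f j x * c j)) x
      = deriv (\<lambda>x. \<Sum>j\<in>I. (deriv ^^ i) (f j) x * c j) x"
  proof (rule deriv_cong_ev)
    show "\<forall>\<^sub>F y in nhds x. (deriv ^^ i) (\<lambda>x. \<Sum>j\<in>I. f j x * c j) y
        = (\<Sum>j\<in>I. (deriv ^^ i) (f j) y * c j)"
      using eventually_nhds_in_open[OF assms(1) \<open>x \<in> S\<close>]
      by eventually_elim (rule Suc.IH, use Suc.prems in auto)
  qed simp
  ultimately show ?case by (simp only: DERIV_imp_deriv funpow.simps(2) comp_apply)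
qed simp

lemma times_differentiable_on_sum:
  fixes f :: "'i \<Rightarrow> real \<Rightarrow> real"
  assumes "open S" and "finite I" and "\<And>j. j \<in> I \<Longrightarrow> times_differentiable_on m (f j) S"
  shows "times_differentiable_on m (\<lambda>x. \<Sum>j\<in>I. f j x * c j) S"
  unfolding times_differentiable_on_def
proof (intro allI impI ballI)
  fix i x assume "i < m" "x \<in> S"
  have "(\<lambda>x. \<Sum>j\<in>I. (deriv ^^ i) (f j) x * c j) differentiable at x"
    using assms(2,3) \<open>i < m\<close> \<open>x \<in> S\<close>
    by (intro differentiable_sum ballI differentiable_mult)
       (auto simp: times_differentiable_on_def)
  moreover have "(deriv ^^ i) (\<lambda>x. \<Sum>j\<in>I. f j x * c j) y = (\<Sum>j\<in>I. (deriv ^^ i) (f j) y * c j)"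
    if "y \<in> S" for y
    by (rule higher_deriv_sum[OF assms _ that]) (use \<open>i < m\<close> in auto)
  ultimately show "(deriv ^^ i) (\<lambda>x. \<Sum>j\<in>I. f j x * c j) differentiable at x"
    by (subst differentiable_cong_open[OF assms(1) _ \<open>x \<in> S\<close>])
qed

lemma frac_kernel_sum:
  "frac_kernel \<alpha> (\<lambda>s. \<Sum>j\<in>I. f j s * c j) t s = (\<Sum>j\<in>I. frac_kernel \<alpha> (f j) t s * c j)"
  by (simp add: frac_kernel_def sum_divide_distrib)

lemma frac_kernel_sum_integrable:
  assumes "finite I" and "\<And>j. j \<in> I \<Longrightarrow> frac_kernel \<alpha> (f j) t absolutely_integrable_on {0..t}"
  shows "frac_kernel \<alpha> (\<lambda>s. \<Sum>j\<in>I. f j s * c j) t absolutely_integrable_on {0..t}"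
  unfolding frac_kernel_sum [abs_def]
  using assms by (intro absolutely_integrable_sum set_integrable_mult_left) auto

lemma integral_frac_kernel_sum:
  assumes "finite I" and "\<And>j. j \<in> I \<Longrightarrow> frac_kernel \<alpha> (f j) t absolutely_integrable_on {0..t}"
  shows "integral {0..t} (frac_kernel \<alpha> (\<lambda>s. \<Sum>j\<in>I. f j s * c j) t)
    = (\<Sum>j\<in>I. integral {0..t} (frac_kernel \<alpha> (f j) t) * c j)"
proof -
  \<comment> \<open>\<open>integral\<close> is the gauge integral, with a default value where none
    exists; absolute integrability rules that out for each summand, so the integral splits.\<close>
  have "frac_kernel \<alpha> (f j) t integrable_on {0..t}" if "j \<in> I" for j
    using assms(2)[OF that] by (rule set_lebesgue_integral_eq_integral(1))
  then show ?thesis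
    unfolding frac_kernel_sum [abs_def] using assms(1)
    by (simp add: integral_sum integrable_on_mult_left)
qed

text \<open>Under the hypotheses below, \<open>g\<close> and \<open>h\<close> may differ at the base point \<open>0\<close>: there the derivative
  of a function that is only differentiable for \<open>t > 0\<close> is a junk value.\<close>

lemma frac_kernel_cong_integrable:
  assumes "\<And>s. s > 0 \<Longrightarrow> g s = h s"
  shows "frac_kernel \<alpha> g t absolutely_integrable_on {0..t} \<longleftrightarrow>
    frac_kernel \<alpha> h t absolutely_integrable_on {0..t}"
  by (rule absolutely_integrable_spike_eq[of "{0}"]) (auto simp: frac_kernel_def assms)

lemma integral_frac_kernel_cong:
  assumes "\<And>s. s > 0 \<Longrightarrow> g s = h s"
  shows "integral {0..t} (frac_kernel \<alpha> g t) = integral {0..t} (frac_kernel \<alpha> h t)"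
  by (rule integral_spike[of "{0}"]) (auto simp: frac_kernel_def assms)

text \<open>Each defining formula is built from linear operations: derivatives, the kernel integral
  and a constant factor. Existence and value share the same case split and the same intermediate
  facts, hence the joint proof.\<close>

lemma frac_sum:
  fixes f :: "'i \<Rightarrow> real \<Rightarrow> real"
  assumes "finite I" and "\<And>j. j \<in> I \<Longrightarrow> frac_differentiable s \<alpha> (f j)"
  shows frac_differentiable_sum: "frac_differentiable s \<alpha> (\<lambda>t. \<Sum>j\<in>I. f j t * c j)" (is ?D)
    and frac_deriv_sum: "\<And>t. t > 0 \<Longrightarrow>
      frac_deriv s \<alpha> (\<lambda>t. \<Sum>j\<in>I. f j t * c j) t = (\<Sum>j\<in>I. frac_deriv s \<alpha> (f j) t * c j)"
      (is "\<And>t. _ \<Longrightarrow> ?E t")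
proof -
  define p where "p = frac_order \<alpha>"
  let ?u = "\<lambda>t. \<Sum>j\<in>I. f j t * c j"
  have op: "open {0::real<..}" by simp
  have "?D \<and> (\<forall>t>0. ?E t)"
  proof (cases "\<alpha> = real p")
    case True
    have ord: "frac_order (real p) = p" by (simp add: frac_order_def)
    \<comment> \<open>At an integer order both senses reduce to the classical derivative, so one
      argument serves both.\<close>
    have td: "times_differentiable_on p (f j) {0<..}" if "j \<in> I" for j
      using assms(2)[OF that] by (cases s) (simp_all add: True ord Let_def)
    show ?thesis
      using times_differentiable_on_sum[OF op assms(1) td]
        higher_deriv_sum[OF op assms(1) td order_refl]
      by (cases s) (simp_all add: True ord Let_def)
  next
    case False
    show ?thesis
    proof (cases s)
      case Caputo
      have td: "times_differentiable_on p (f j) {0<..}" if "j \<in> I" for j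
        using assms(2)[OF that] Caputo by (simp add: p_def[symmetric] Let_def)
      have int: "frac_kernel \<alpha> ((deriv ^^ p) (f j)) t absolutely_integrable_on {0..t}"
        if "j \<in> I" "t > 0" for j t
        using assms(2)[OF that(1)] that(2) Caputo False by (simp add: p_def[symmetric] Let_def)
      \<comment> \<open>Available only for positive times; the integrals below start at 0, which is
        why they are compared through the congruence lemmas that ignore the base point.\<close>
      have D: "(deriv ^^ p) ?u t = (\<Sum>j\<in>I. (deriv ^^ p) (f j) t * c j)" if "t > 0" for t
        using higher_deriv_sum[OF op assms(1) td order_refl] that by simp
      have "frac_kernel \<alpha> ((deriv ^^ p) ?u) t absolutely_integrable_on {0..t}" if "t > 0" for t
        by (subst frac_kernel_cong_integrable[where h = "(\<lambda>s. \<Sum>j\<in>I. (deriv ^^ p) (f j) s * c j)"], erule D)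
           (rule frac_kernel_sum_integrable[OF assms(1) int[OF _ that]])
      moreover have "integral {0..t} (frac_kernel \<alpha> ((deriv ^^ p) ?u) t)
          = (\<Sum>j\<in>I. integral {0..t} (frac_kernel \<alpha> ((deriv ^^ p) (f j)) t) * c j)" if "t > 0" for t
        by (subst integral_frac_kernel_cong[where h = "(\<lambda>s. \<Sum>j\<in>I. (deriv ^^ p) (f j) s * c j)"], erule D)
           (rule integral_frac_kernel_sum[OF assms(1) int[OF _ that]])
      ultimately show ?thesis
        using False times_differentiable_on_sum[OF op assms(1) td]
        by (simp add: Caputo p_def[symmetric] Let_def sum_distrib_left mult.assoc sum_divide_distrib)
    next
      case Riemann_Liouville
      let ?F = "\<lambda>g r. integral {0..r} (frac_kernel \<alpha> g r)"
      have int: "frac_kernel \<alpha> (f j) t absolutely_integrable_on {0..t}"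
        if "j \<in> I" "t > 0" for j t
        using assms(2)[OF that(1)] that(2) Riemann_Liouville False
        by (simp add: p_def[symmetric] Let_def)
      have td: "times_differentiable_on p (?F (f j)) {0<..}" if "j \<in> I" for j
        using assms(2)[OF that(1)] Riemann_Liouville False by (simp add: p_def[symmetric] Let_def)
      \<comment> \<open>Here the integral comes before the derivatives. The identity holds on the
        open half-line, which is enough to transfer both differentiability and the
        \<open>p\<close>-th derivative.\<close>
      have F: "?F ?u r = (\<Sum>j\<in>I. ?F (f j) r * c j)" if "r \<in> {0<..}" for r
        using integral_frac_kernel_sum[OF assms(1) int] that by simp
      have "times_differentiable_on p (?F ?u) {0<..}"
        by (subst times_differentiable_on_cong[where g = "\<lambda>r. \<Sum>j\<in>I. ?F (f j) r * c j", OF op], erule F)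
           (rule times_differentiable_on_sum[OF op assms(1) td])
      moreover have "(deriv ^^ p) (?F ?u) t = (\<Sum>j\<in>I. (deriv ^^ p) (?F (f j)) t * c j)"
        if "t > 0" for t
      proof -
        have t: "t \<in> {0<..}" using that by simp
        show ?thesis
          by (subst higher_deriv_cong_open[where g = "\<lambda>r. \<Sum>j\<in>I. ?F (f j) r * c j", OF op _ t], erule F)
             (rule higher_deriv_sum[OF op assms(1) td order_refl t])
      qed
      ultimately show ?thesis
        using False frac_kernel_sum_integrable[OF assms(1) int]
        by (simp add: Riemann_Liouville p_def[symmetric] Let_def sum_distrib_left mult.assoc
            sum_divide_distrib)
    qed
  qed
  then show ?D and "\<And>t. t > 0 \<Longrightarrow> ?E t" by blast+
qed

text \<open>The equation expresses \<open>z\<^sup>(\<^sup>n\<^sup>)\<close> through lower derivatives, so \<open>z\<^sup>(\<^sup>n\<^sup>)\<close> is again differentiable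
  and the equation itself may be differentiated.\<close>

lemma ode_solution_space_deriv:
  assumes "a n \<noteq> 0" and z: "z \<in> ode_solution_space n a"
  shows "deriv z \<in> ode_solution_space n a"
proof -
  have low: "(deriv ^^ i) z differentiable at x" if "i < n" for i x
    using z that by (simp add: ode_solution_space_def times_differentiable_on_def)
  have eq: "(\<Sum>i\<le>n. a i * (deriv ^^ i) z x) = 0" for x
    using z by (simp add: ode_solution_space_def)
  have "(deriv ^^ n) z = (\<lambda>x. - (\<Sum>i<n. a i * (deriv ^^ i) z x) / a n)"
  proof
    fix x
    have "(\<Sum>i<n. a i * (deriv ^^ i) z x) + a n * (deriv ^^ n) z x = 0"
      using eq[of x] by (simp add: lessThan_Suc_atMost[symmetric])
    then show "(deriv ^^ n) z x = - (\<Sum>i<n. a i * (deriv ^^ i) z x) / a n"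
      using assms(1) by (simp add: field_simps)
  qed
  moreover have "(\<lambda>x. - (\<Sum>i<n. a i * (deriv ^^ i) z x) / a n) differentiable at x" for x
    using low assms(1) by (intro derivative_intros) auto
  ultimately have diff: "(deriv ^^ i) z differentiable at x" if "i \<le> n" for i x
    using low that by (metis le_neq_implies_less)
  have "((\<lambda>x. \<Sum>i\<le>n. a i * (deriv ^^ i) z x) has_real_derivative
      (\<Sum>i\<le>n. a i * (deriv ^^ Suc i) z x)) (at x)" for x
    using diff by (intro DERIV_sum DERIV_cmult) (simp add: DERIV_deriv_iff_real_differentiable)
  then have "(\<Sum>i\<le>n. a i * (deriv ^^ Suc i) z x) = 0" for x
    unfolding eq by (metis DERIV_const DERIV_unique)
  moreover have "(deriv ^^ i) (deriv z) = (deriv ^^ Suc i) z" for i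
    by (simp only: funpow_Suc_right comp_apply)
  ultimately show ?thesis
    using diff by (simp add: ode_solution_space_def times_differentiable_on_def del: funpow.simps)
qed

text \<open>Membership controls only orders up to \<open>n\<close>, whereas the operator reads
  derivatives up to an arbitrary \<open>k\<close>. As the space is closed under
  \<open>deriv\<close>, every iterate lies in it, and since \<open>n > 0\<close> each member is
  differentiable.\<close>

lemma ode_solution_smooth:
  assumes "a n \<noteq> 0" and "n > 0" and z: "z \<in> ode_solution_space n a"
  shows "times_differentiable_on k z UNIV"
proof -
  have "(deriv ^^ i) z \<in> ode_solution_space n a" for i
    by (induction i) (simp_all add: z ode_solution_space_deriv[of a n, OF assms(1)])
  then show ?thesis
    using \<open>n > 0\<close> by (force simp: ode_solution_space_def times_differentiable_on_def)
qed

lemma lin_comb_inject: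
  assumes "fun_independent \<phi>" and "lin_comb \<phi> c = lin_comb \<phi> d"
  shows "c = d"
proof -
  have "lin_comb \<phi> (c - d) x = lin_comb \<phi> c x - lin_comb \<phi> d x" for x
    by (simp add: lin_comb_def left_diff_distrib sum_subtractf)
  then have "c - d = 0"
    using assms unfolding fun_independent_def by (metis diff_self)
  then show ?thesis by simp
qed

text \<open>Invariance yields coefficients for each pair of arguments, choice assembles them into a
  function, and independence leaves no freedom in them.\<close>

lemma ex1_coefficient_functions:
  assumes "fun_independent \<phi>" and "invariant_under (fun_span \<phi>) G"
  shows "\<exists>!\<Psi>. coefficient_functions G \<phi> \<Psi>"
proof -
  have "\<exists>c. G (lin_comb \<phi> A) (lin_comb \<phi> B) = lin_comb \<phi> c" for A B
    using assms(2) by (auto simp: invariant_under_def fun_span_def)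
  then obtain \<Psi> where "coefficient_functions G \<phi> \<Psi>"
    unfolding coefficient_functions_def by metis
  moreover have "\<Psi>1 = \<Psi>2"
    if "coefficient_functions G \<phi> \<Psi>1" "coefficient_functions G \<phi> \<Psi>2" for \<Psi>1 \<Psi>2
    using that lin_comb_inject[OF assms(1)] unfolding coefficient_functions_def
    by (intro ext) metis
  ultimately show ?thesis by blast
qed

theorem theorem5p2:
  fixes \<alpha> \<tau> :: real and k :: nat and s :: frac_sense
    and a :: "nat \<Rightarrow> real" and \<phi> :: "'n::finite \<Rightarrow> real \<Rightarrow> real"
    and G' :: "real \<Rightarrow> real list \<Rightarrow> real list \<Rightarrow> real"
  assumes "\<alpha> > 0" and "\<tau> > 0"
    and "a CARD('n) \<noteq> 0"
    and "fun_independent \<phi>"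
    and "fun_span \<phi> = ode_solution_space CARD('n) a"
    and "invariant_under (fun_span \<phi>) (diff_operator k G')"
  shows "(\<exists>!\<Psi>. coefficient_functions (diff_operator k G') \<phi> \<Psi>) \<and>
    (\<forall>\<Psi> h A. coefficient_functions (diff_operator k G') \<phi> \<Psi> \<longrightarrow>
       delay_system_solution s \<alpha> \<tau> \<Psi> h A \<longrightarrow>
       delay_pde_solution s \<alpha> \<tau> k G'
         (\<lambda>x t. \<Sum>j\<in>UNIV. h t $ j * \<phi> j x) (\<lambda>x t. \<Sum>j\<in>UNIV. A t $ j * \<phi> j x))"
proof (intro conjI allI impI)
  show "\<exists>!\<Psi>. coefficient_functions (diff_operator k G') \<phi> \<Psi>"
    using assms(4,6) by (rule ex1_coefficient_functions)
next
  fix \<Psi> :: "real ^ 'n \<Rightarrow> real ^ 'n \<Rightarrow> real ^ 'n" and h A :: "real \<Rightarrow> real ^ 'n"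
  assume \<Psi>: "coefficient_functions (diff_operator k G') \<phi> \<Psi>"
    and "delay_system_solution s \<alpha> \<tau> \<Psi> h A"
  then have hist: "\<And>t. t \<in> {-\<tau>..0} \<Longrightarrow> A t = h t"
    and fd: "\<And>j. frac_differentiable s \<alpha> (\<lambda>t. A t $ j)"
    and sys: "\<And>j t. t > 0 \<Longrightarrow> frac_deriv s \<alpha> (\<lambda>r. A r $ j) t = \<Psi> (A t) (A (t - \<tau>)) $ j"
    by (auto simp: delay_system_solution_def)
  have u: "(\<lambda>x. \<Sum>j\<in>UNIV. A t $ j * \<phi> j x) = lin_comb \<phi> (A t)" for t
    by (simp add: lin_comb_def)
  \<comment> \<open>At each time the profile is an element of the span, whatever the regularity of
    \<open>A\<close> in time.\<close>
  have "times_differentiable_on k (lin_comb \<phi> (A t)) UNIV" for t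
    using assms(3,5) by (intro ode_solution_smooth[of a "CARD('n)"]) (auto simp: fun_span_def)
  moreover have "frac_deriv s \<alpha> (\<lambda>t. \<Sum>j\<in>UNIV. A t $ j * \<phi> j x) t
      = diff_operator k G' (lin_comb \<phi> (A t)) (lin_comb \<phi> (A (t - \<tau>))) x" if "t > 0" for x t
  proof -
    have "frac_deriv s \<alpha> (\<lambda>t. \<Sum>j\<in>UNIV. A t $ j * \<phi> j x) t
        = lin_comb \<phi> (\<Psi> (A t) (A (t - \<tau>))) x"
      using frac_deriv_sum[where f = "\<lambda>j t. A t $ j", OF finite fd that] sys[OF that] by (simp add: lin_comb_def)
    then show ?thesis using \<Psi> by (simp add: coefficient_functions_def)
  qed
  ultimately show "delay_pde_solution s \<alpha> \<tau> k G'
      (\<lambda>x t. \<Sum>j\<in>UNIV. h t $ j * \<phi> j x) (\<lambda>x t. \<Sum>j\<in>UNIV. A t $ j * \<phi> j x)"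
    unfolding delay_pde_solution_def u
    using hist frac_differentiable_sum[where f = "\<lambda>j t. A t $ j", OF finite fd] by simp
qed

end
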